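(* Fix $\delta>0$. (i) Suppose $f\in\mathcal{C}_\delta^\omega(\mathbb{T},\mathbb{C})$ does not vanish identically but possesses zeros on $\mathbb{T}$. Then for every $0<\alpha<l(f)^{-1}$ there is $\epsilon_0>0$ such that $f$ satisfies an $(\alpha,\epsilon_0)$-transversality condition. (ii) Let $f\in\mathcal{C}_\delta^\omega(\mathbb{T},\mathbb{C})$ not vanish identically. Then for every $0<\alpha\le1$ with $\alpha<l(f)^{-1}$ there is $\epsilon_0=\epsilon_0(f,\alpha)>0$ such that $f$ lies in the interior of $\mathcal{T}_\alpha^{\epsilon_0}$, the interior being taken in $\mathcal{C}_\delta^\omega(\mathbb{T},\mathbb{C})$ with respect to the topology induced by $\|\cdot\|_\delta$.
   Context: $\mathbb{T}=\mathbb{R}/\mathbb{Z}$ carries its Haar probability measure $\mu$. For $\delta>0$, $\mathcal{C}_\delta^\omega(\mathbb{T},\mathbb{C})$ denotes the complex-valued analytic (1-periodic) functions on $\mathbb{T}$ that extend holomorphically to a neighborhood of the strip $\{|\mathrm{Im}\, z|\le\delta\}$, with the norm $\|f\|_\delta:=\sup_{|\mathrm{Im}\, z|\le\delta}|f(z)|$. Given $0<\alpha\le1$ and $\epsilon_0>0$, a function $g\in\mathcal{C}_\delta^\omega(\mathbb{T},\mathbb{C})$ satisfies an $(\alpha,\epsilon_0)$-transversality condition if $\mu\{x\in\mathbb{T}:|g(x)|<\epsilon\}<\epsilon^\alpha$ for every $0<\epsilon<\epsilon_0$. The class of such functions is denoted $\mathcal{T}_\alpha^{\epsilon_0}$. For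 $f$ not identically zero, $l(f)$ denotes the maximal multiplicity of the distinct zeros of $f$ on $\mathbb{T}$; $l(f)=0$ if $f$ has no zeros on $\mathbb{T}$, in which case $l(f)^{-1}$ is read as $+\infty$. *)

theory Defs
  imports "HOL-Complex_Analysis.Complex_Analysis"
begin

text \<open>
  Functions on the circle R/Z are modelled as functions on the reals with period 1, and the Haar
  probability measure as Lebesgue measure on the fundamental domain [0,1).
\<close>

definition circle_measure :: "real measure" where
  "circle_measure = restrict_space lborel {0..<1}"

lemma space_circle_measure [simp]: "space circle_measure = {0..<1}"
  by (simp add: circle_measure_def space_restrict_space)

lemma emeasure_space_circle_measure: "emeasure circle_measure (space circle_measure) = 1"
  by (simp add: circle_measure_def space_restrict_space emeasure_restrict_space)

definition strip :: "real \<Rightarrow> complex set" where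
  "strip \<delta> = {z. \<bar>Im z\<bar> \<le> \<delta>}"

text \<open>
  By \<open>analytic_on_holomorphic\<close>, being analytic on the closed strip means being holomorphic on
  some open set containing it.
\<close>

definition extends_to_strip :: "real \<Rightarrow> (real \<Rightarrow> complex) \<Rightarrow> (complex \<Rightarrow> complex) \<Rightarrow> bool" where
  "extends_to_strip \<delta> f F \<longleftrightarrow> F analytic_on strip \<delta> \<and> (\<forall>x. F (of_real x) = f x)"

definition analytic_circle :: "real \<Rightarrow> (real \<Rightarrow> complex) set" where
  "analytic_circle \<delta> = {f. (\<forall>x. f (x + 1) = f x) \<and> (\<exists>F. extends_to_strip \<delta> f F)}"

text \<open>
  The extension is unique on the strip (see \<open>extends_to_strip_unique\<close>), so the choice made here
  only affects values outside it.
\<close>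

definition strip_ext :: "real \<Rightarrow> (real \<Rightarrow> complex) \<Rightarrow> complex \<Rightarrow> complex" where
  "strip_ext \<delta> f = (SOME F. extends_to_strip \<delta> f F)"

definition strip_norm :: "real \<Rightarrow> (real \<Rightarrow> complex) \<Rightarrow> real" where
  "strip_norm \<delta> f = (SUP z\<in>strip \<delta>. norm (strip_ext \<delta> f z))"

text \<open>
  The guard is needed because the locale \<open>Metric_space\<close> asks for nonnegativity of the distance
  also outside the carrier.
\<close>

definition strip_dist :: "real \<Rightarrow> (real \<Rightarrow> complex) \<Rightarrow> (real \<Rightarrow> complex) \<Rightarrow> real" where
  "strip_dist \<delta> f g =
    (if f \<in> analytic_circle \<delta> \<and> g \<in> analytic_circle \<delta> then strip_norm \<delta> (\<lambda>x. f x - g x) else 0)"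

definition strip_topology :: "real \<Rightarrow> (real \<Rightarrow> complex) topology" where
  "strip_topology \<delta> = Metric_space.mtopology (analytic_circle \<delta>) (strip_dist \<delta>)"

definition transversality_class :: "real \<Rightarrow> real \<Rightarrow> real \<Rightarrow> (real \<Rightarrow> complex) set" where
  "transversality_class \<delta> \<alpha> \<epsilon>\<^sub>0 =
    {g \<in> analytic_circle \<delta>. \<forall>\<epsilon>. 0 < \<epsilon> \<and> \<epsilon> < \<epsilon>\<^sub>0 \<longrightarrow>
       measure circle_measure {x \<in> space circle_measure. norm (g x) < \<epsilon>} < \<epsilon> powr \<alpha>}"

definition circle_zeros :: "(real \<Rightarrow> complex) \<Rightarrow> real set" where
  "circle_zeros f = {x \<in> {0..<1}. f x = 0}"

definition max_zero_multiplicity :: "real \<Rightarrow> (real \<Rightarrow> complex) \<Rightarrow> nat" where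
  "max_zero_multiplicity \<delta> f =
    (if circle_zeros f = {} then 0
     else Max ((\<lambda>x. nat (zorder (strip_ext \<delta> f) (of_real x))) ` circle_zeros f))"

text \<open>
  The reciprocal of the maximal multiplicity as an extended real; on \<open>ereal\<close> the inverse of 0
  is infinity.
\<close>

definition inverse_max_multiplicity :: "real \<Rightarrow> (real \<Rightarrow> complex) \<Rightarrow> ereal" where
  "inverse_max_multiplicity \<delta> f = inverse (ereal (real (max_zero_multiplicity \<delta> f)))"

lemma extends_to_strip_unique:
  assumes "\<delta> \<ge> 0" "extends_to_strip \<delta> f F" "extends_to_strip \<delta> f G" "z \<in> strip \<delta>"
  shows "F z = G z"
proof -
  have "(\<lambda>z. F z - G z) analytic_on strip \<delta>"
    using assms by (auto simp: extends_to_strip_def intro: analytic_on_diff)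
  then obtain S where S: "open S" "strip \<delta> \<subseteq> S" "(\<lambda>z. F z - G z) holomorphic_on S"
    by (auto simp: analytic_on_holomorphic)
  define T where "T = connected_component_set S 0"
  have strip_eq: "strip \<delta> = {z. Im z \<le> \<delta>} \<inter> {z. Im z \<ge> -\<delta>}"
    by (auto simp: strip_def)
  have "convex (strip \<delta>)"
    unfolding strip_eq by (intro convex_Int convex_halfspace_Im_le convex_halfspace_Im_ge)
  moreover have "0 \<in> strip \<delta>" using assms(1) by (simp add: strip_def)
  ultimately have T: "strip \<delta> \<subseteq> T"
    unfolding T_def using S(2) by (intro connected_component_maximal) (auto intro: convex_connected)
  have "F z - G z = 0"
  proof (rule analytic_continuation[where S = T and U = "range of_real" and \<xi> = 0
        and f = "\<lambda>z. F z - G z"])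
    show "(\<lambda>z. F z - G z) holomorphic_on T"
      using S(3) holomorphic_on_subset connected_component_subset unfolding T_def by blast
    show "open T" "connected T"
      unfolding T_def using S(1) by (auto simp: open_connected_component)
    show "range complex_of_real \<subseteq> T" "0 \<in> T" "z \<in> T"
      using T assms by (auto simp: strip_def)
    show "(0::complex) islimpt range of_real"
    proof (rule islimptI)
      fix U :: "complex set" assume "0 \<in> U" "open U"
      then obtain e where e: "e > 0" "ball 0 e \<subseteq> U" by (meson openE)
      have "complex_of_real (e/2) \<in> ball 0 e" using e by simp
      then show "\<exists>y\<in>range complex_of_real. y \<in> U \<and> y \<noteq> 0"
        using e by (intro bexI[of _ "complex_of_real (e/2)"] rangeI) auto
    qed
    fix w assume "w \<in> range complex_of_real"
    then show "F w - G w = 0" using assms by (auto simp: extends_to_strip_def)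
  qed
  then show ?thesis by simp
qed

lemma extends_to_strip_ext: "f \<in> analytic_circle \<delta> \<Longrightarrow> extends_to_strip \<delta> f (strip_ext \<delta> f)"
  unfolding strip_ext_def analytic_circle_def
  by (auto intro: someI[where P = "extends_to_strip \<delta> f"])

lemma strip_norm_eq:
  assumes "\<delta> \<ge> 0" "extends_to_strip \<delta> f F"
  shows "strip_norm \<delta> f = (SUP z\<in>strip \<delta>. norm (F z))"
proof -
  have "extends_to_strip \<delta> f (strip_ext \<delta> f)"
    unfolding strip_ext_def using assms(2)
    by (rule someI[where P = "extends_to_strip \<delta> f"])
  then show ?thesis
    unfolding strip_norm_def using extends_to_strip_unique[OF assms(1) _ assms(2)]
    by (intro arg_cong[where f = Sup] image_cong) auto
qed

lemma strip_ext_periodic: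
  assumes "\<delta> \<ge> 0" "f \<in> analytic_circle \<delta>" "z \<in> strip \<delta>"
  shows "strip_ext \<delta> f (z + of_int n) = strip_ext \<delta> f z"
proof -
  let ?F = "strip_ext \<delta> f"
  have F: "?F analytic_on strip \<delta>" "\<And>x. ?F (of_real x) = f x"
    using extends_to_strip_ext[OF assms(2)] by (auto simp: extends_to_strip_def)
  have step: "?F (w + 1) = ?F w" if "w \<in> strip \<delta>" for w
  proof (rule extends_to_strip_unique[OF assms(1) _ extends_to_strip_ext[OF assms(2)] that])
    have "(?F \<circ> (\<lambda>w. w + 1)) analytic_on strip \<delta>"
    proof (rule analytic_on_compose)
      show "(\<lambda>w. w + 1) analytic_on strip \<delta>" by (intro analytic_intros)
      have "(\<lambda>w. w + 1) ` strip \<delta> \<subseteq> strip \<delta>" by (auto simp: strip_def)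
      then show "?F analytic_on (\<lambda>w. w + 1) ` strip \<delta>" using F(1) analytic_on_subset by blast
    qed
    moreover have "?F (of_real x + 1) = f x" for x
      using F(2)[of "x + 1"] assms(2) by (simp add: analytic_circle_def)
    ultimately show "extends_to_strip \<delta> f (\<lambda>w. ?F (w + 1))"
      by (simp add: extends_to_strip_def o_def)
  qed
  show ?thesis
  proof (induction n rule: int_induct[where k = 0])
    case base
    show ?case by simp
  next
    case (step1 i)
    have "z + of_int i \<in> strip \<delta>" using assms(3) by (simp add: strip_def)
    from step[OF this] step1 show ?case by (simp add: add_ac)
  next
    case (step2 i)
    have "z + of_int (i - 1) \<in> strip \<delta>" using assms(3) by (simp add: strip_def)
    from step[OF this] step2 show ?case by simp
  qed
qed

lemma strip_ext_bounded:
  assumes "\<delta> \<ge> 0" "f \<in> analytic_circle \<delta>"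
  shows "bdd_above ((\<lambda>z. norm (strip_ext \<delta> f z)) ` strip \<delta>)"
proof -
  let ?F = "strip_ext \<delta> f"
  define K where "K = cbox (Complex 0 (-\<delta>)) (Complex 1 \<delta>)"
  have K: "K \<subseteq> strip \<delta>" by (auto simp: K_def in_cbox_complex_iff strip_def)
  have "?F analytic_on strip \<delta>"
    using extends_to_strip_ext[OF assms(2)] by (simp add: extends_to_strip_def)
  then have "continuous_on K ?F"
    using K by (meson analytic_imp_holomorphic analytic_on_subset holomorphic_on_imp_continuous_on)
  then have "compact (?F ` K)"
    by (intro compact_continuous_image) (auto simp: K_def)
  then obtain B where B: "\<And>w. w \<in> K \<Longrightarrow> norm (?F w) \<le> B"
    by (meson bounded_iff compact_imp_bounded imageI)
  have "norm (?F z) \<le> B" if "z \<in> strip \<delta>" for z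
  proof -
    define w where "w = z + of_int (- \<lfloor>Re z\<rfloor>)"
    have "0 \<le> Re w" "Re w \<le> 1"
      unfolding w_def by (auto, linarith)
    then have "w \<in> K"
      using that by (auto simp: K_def in_cbox_complex_iff strip_def w_def)
    then show ?thesis
      using B strip_ext_periodic[OF assms that] by (metis w_def)
  qed
  then show ?thesis by (rule bdd_aboveI2)
qed

lemma analytic_circle_diff:
  assumes "f \<in> analytic_circle \<delta>" "g \<in> analytic_circle \<delta>"
  shows "(\<lambda>x. f x - g x) \<in> analytic_circle \<delta>"
    and "extends_to_strip \<delta> (\<lambda>x. f x - g x) (\<lambda>z. strip_ext \<delta> f z - strip_ext \<delta> g z)"
proof -
  show "extends_to_strip \<delta> (\<lambda>x. f x - g x) (\<lambda>z. strip_ext \<delta> f z - strip_ext \<delta> g z)"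
    using extends_to_strip_ext[OF assms(1)] extends_to_strip_ext[OF assms(2)]
    by (auto simp: extends_to_strip_def intro: analytic_on_diff)
  then show "(\<lambda>x. f x - g x) \<in> analytic_circle \<delta>"
    using assms by (auto simp: analytic_circle_def)
qed

lemma norm_le_strip_norm:
  assumes "\<delta> \<ge> 0" "f \<in> analytic_circle \<delta>" "z \<in> strip \<delta>"
  shows "norm (strip_ext \<delta> f z) \<le> strip_norm \<delta> f"
  unfolding strip_norm_def using assms by (intro cSUP_upper strip_ext_bounded)

lemma Metric_space_strip_dist:
  assumes "\<delta> \<ge> 0"
  shows "Metric_space (analytic_circle \<delta>) (strip_dist \<delta>)"
proof
  have ne: "strip \<delta> \<noteq> {}" using assms by (auto simp: strip_def intro!: exI[of _ 0])
  have 0: "0 \<in> strip \<delta>" using assms by (simp add: strip_def)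
  have dist_eq: "strip_dist \<delta> f g = (SUP z\<in>strip \<delta>. norm (strip_ext \<delta> f z - strip_ext \<delta> g z))"
    if "f \<in> analytic_circle \<delta>" "g \<in> analytic_circle \<delta>" for f g
    using that strip_norm_eq[OF assms analytic_circle_diff(2)[OF that]] by (simp add: strip_dist_def)
  have le: "norm (strip_ext \<delta> f z - strip_ext \<delta> g z) \<le> strip_dist \<delta> f g"
    if fg: "f \<in> analytic_circle \<delta>" "g \<in> analytic_circle \<delta>" and z: "z \<in> strip \<delta>" for f g z
    using norm_le_strip_norm[OF assms analytic_circle_diff(1)[OF fg] z]
      extends_to_strip_unique[OF assms extends_to_strip_ext[OF analytic_circle_diff(1)[OF fg]]
        analytic_circle_diff(2)[OF fg] z] fg
    by (simp add: strip_dist_def)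
  show "0 \<le> strip_dist \<delta> f g" for f g
  proof (cases "f \<in> analytic_circle \<delta> \<and> g \<in> analytic_circle \<delta>")
    case True
    then show ?thesis using le[of f g 0] 0 norm_ge_zero order_trans by blast
  qed (auto simp: strip_dist_def)
  show "strip_dist \<delta> f g = strip_dist \<delta> g f" for f g
  proof (cases "f \<in> analytic_circle \<delta> \<and> g \<in> analytic_circle \<delta>")
    case True
    then show ?thesis by (simp add: dist_eq norm_minus_commute)
  qed (auto simp: strip_dist_def)
  show "strip_dist \<delta> f g = 0 \<longleftrightarrow> f = g"
    if fg: "f \<in> analytic_circle \<delta>" "g \<in> analytic_circle \<delta>" for f g
  proof
    assume "strip_dist \<delta> f g = 0"
    then have "strip_ext \<delta> f (of_real x) = strip_ext \<delta> g (of_real x)" for x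
      using le[OF fg, of "of_real x"] assms by (simp add: strip_def)
    then show "f = g"
      using extends_to_strip_ext[OF fg(1)] extends_to_strip_ext[OF fg(2)]
      by (simp add: extends_to_strip_def fun_eq_iff)
  qed (use fg ne in \<open>simp add: dist_eq\<close>)
  show "strip_dist \<delta> f h \<le> strip_dist \<delta> f g + strip_dist \<delta> g h"
    if fgh: "f \<in> analytic_circle \<delta>" "g \<in> analytic_circle \<delta>" "h \<in> analytic_circle \<delta>" for f g h
    unfolding dist_eq[OF fgh(1,3)]
  proof (rule cSUP_least[OF ne])
    fix z assume z: "z \<in> strip \<delta>"
    show "norm (strip_ext \<delta> f z - strip_ext \<delta> h z) \<le> strip_dist \<delta> f g + strip_dist \<delta> g h"
      using le[OF fgh(1,2) z] le[OF fgh(2,3) z]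
        norm_triangle_ineq[of "strip_ext \<delta> f z - strip_ext \<delta> g z"
          "strip_ext \<delta> g z - strip_ext \<delta> h z"]
      by simp
  qed
qed

end

theory Submission
  imports Defs "HOL-Real_Asymp.Real_Asymp"
begin

text \<open>
  At each point \<open>x\<^sub>0\<close> some derivative of \<open>f\<close> of order \<open>m \<le> l(f)\<close> does not vanish. By Cauchy's
  inequalities the derivative of order \<open>m\<close> of every \<open>g\<close> close to \<open>f\<close>, rotated by a fixed phase, has
  real part bounded below near \<open>x\<^sub>0\<close>, so that \<open>{\<bar>g\<bar> < \<epsilon>}\<close> has measure \<open>O(\<epsilon>\<^bsup>1/m\<^esup>)\<close> there, uniformly
  in \<open>g\<close>. Compactness of the circle makes this global, and \<open>\<alpha> < 1/l(f)\<close> absorbs the constants.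
  Part (i) is a consequence of part (ii).
\<close>

section \<open>Sublevel sets of real functions with a derivative bounded below\<close>

text \<open>By continuity on \<open>I\<close> the set is \<open>I\<close> intersected with an open
  set, and a bounded interval has finite Lebesgue measure.\<close>

lemma lmeasurable_sublevel:
  fixes h :: "real \<Rightarrow> 'a::real_normed_vector"
  assumes "is_interval I" "bounded I" "continuous_on I h"
  shows "{x\<in>I. norm (h x) < s} \<in> lmeasurable"
proof -
  have "openin (top_of_set I) (I \<inter> h -` ball 0 s)"
    using assms(3) by (simp add: continuous_openin_preimage_gen)
  then obtain T where "open T" "I \<inter> h -` ball 0 s = I \<inter> T"
    by (auto simp: openin_open)
  moreover have "{x\<in>I. norm (h x) < s} = I \<inter> h -` ball 0 s"
    by auto
  moreover have "I \<in> lmeasurable"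
    using assms by (intro measurable_convex is_interval_convex)
  ultimately show ?thesis
    by (auto intro: fmeasurable_Int_fmeasurable)
qed

text \<open>\<open>E\<close> lies in the interval of radius \<open>s\<close> about any of its
  points. The constant 2 spares a discussion of infimum and supremum and costs only a
  factor.\<close>

lemma measure_le_of_diameter:
  fixes E :: "real set"
  assumes "E \<in> sets lebesgue" "\<And>x y. x \<in> E \<Longrightarrow> y \<in> E \<Longrightarrow> \<bar>x - y\<bar> \<le> s" "s \<ge> 0"
  shows "measure lebesgue E \<le> 2 * s"
proof (cases "E = {}")
  case False
  then obtain x where "x \<in> E" by blast
  then have "E \<subseteq> {x - s..x + s}"
    using assms(2)[of x] by (force simp: abs_le_iff)
  then have "measure lebesgue E \<le> measure lebesgue {x - s..x + s}"
    using assms(1) by (intro measure_mono_fmeasurable) auto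
  then show ?thesis
    using assms(3) by simp
qed (use assms(3) in simp)

lemma derivative_ge_imp_expanding:
  fixes h :: "real \<Rightarrow> real"
  assumes I: "is_interval I" and xy: "x \<in> I" "y \<in> I" "x \<le> y"
    and d: "\<And>u. u \<in> I \<Longrightarrow> (h has_real_derivative h' u) (at u)" "\<And>u. u \<in> I \<Longrightarrow> \<kappa> \<le> h' u"
  shows "\<kappa> * (y - x) \<le> h y - h x"
proof (cases "x = y")
  case False
  have sub: "u \<in> I" if "x \<le> u" "u \<le> y" for u
    using I xy that by (meson mem_is_interval_1_I)
  obtain z where "x < z" "z < y" "h y - h x = (y - x) * h' z"
    using MVT2[of x y h h'] False xy(3) d(1) sub by (metis order_le_less)
  moreover have "\<kappa> \<le> h' z"
    using sub d(2) \<open>x < z\<close> \<open>z < y\<close> by simp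
  ultimately show ?thesis
    using xy(3) mult_right_mono[of \<kappa> "h' z" "y - x"] by (simp add: mult.commute)
qed simp

text \<open>
  Since the derivative of order \<open>m\<close> is increasing, \<open>I\<close> splits into a short interval where it is
  small and two intervals where the induction hypothesis applies to the derivative of order \<open>m\<close>.
\<close>

lemma measure_sublevel_le:
  fixes d :: "nat \<Rightarrow> real \<Rightarrow> real"
  assumes "is_interval I" "bounded I"
    and "\<And>i x. i < m \<Longrightarrow> x \<in> I \<Longrightarrow> (d i has_real_derivative d (Suc i) x) (at x)"
    and "\<And>x. x \<in> I \<Longrightarrow> \<kappa> \<le> d m x" "\<kappa> > 0" "t > 0"
  shows "measure lebesgue {x\<in>I. \<bar>d 0 x\<bar> < \<kappa> * t ^ m} \<le> 4 * (2 ^ m - 1) * t"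
  using assms
proof (induction m arbitrary: I d \<kappa>)
  case 0
  \<comment> \<open>The bound on \<open>d 0\<close> itself excludes values below
    \<open>\<kappa>\<close>; this matches the factor \<open>2 ^ 0 - 1 = 0\<close>.\<close>
  then have empty: "{x\<in>I. \<bar>d 0 x\<bar> < \<kappa>} = {}" by force
  show ?case by (simp add: empty)
next
  case (Suc m)
  note I = Suc.prems(1,2) and deriv = Suc.prems(3) and pos = Suc.prems(5,6)
  \<comment> \<open>Since \<open>\<tau> * t ^ m = \<kappa> * t ^ Suc m\<close>, the level of
    \<open>d 0\<close> stays the same when the induction hypothesis is used with
    \<open>\<tau>\<close> in place of \<open>\<kappa>\<close>.\<close>
  define \<tau> where "\<tau> = \<kappa> * t"
  have \<tau>: "\<tau> > 0" using pos by (simp add: \<tau>_def)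
  define E where "E = {x\<in>I. \<bar>d 0 x\<bar> < \<tau> * t ^ m}"
  define L where "L = {x\<in>I. d m x \<le> -\<tau>}"
  define M where "M = {x\<in>I. \<bar>d m x\<bar> < \<tau>}"
  define R where "R = {x\<in>I. \<tau> \<le> d m x}"
  have expand: "\<kappa> * (y - x) \<le> d m y - d m x" if "x \<in> I" "y \<in> I" "x \<le> y" for x y
    by (rule derivative_ge_imp_expanding[where h' = "d (Suc m)", OF I(1) that])
      (use deriv Suc.prems(4) in auto)
  have mono: "d m x \<le> d m y" if "x \<in> I" "y \<in> I" "x \<le> y" for x y
    using expand[OF that] that(3) pos(1) by (smt (verit) mult_nonneg_nonneg)
  have btw: "u \<in> I \<and> d m x \<le> d m u \<and> d m u \<le> d m y" if "x \<in> I" "y \<in> I" "x \<le> u" "u \<le> y" for x u y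
    using that I(1) mono by (metis mem_is_interval_1_I)
  \<comment> \<open>As \<open>d m\<close> is monotone on \<open>I\<close>, preimages of intervals
    are intervals; this makes \<open>L\<close> and \<open>R\<close> admissible domains for the
    induction hypothesis and \<open>M\<close> measurable.\<close>
  have preimage: "is_interval {x\<in>I. d m x \<in> J}" if J: "is_interval J" for J
    unfolding is_interval_1
  proof (intro ballI allI impI)
    fix x y u assume "x \<in> {x\<in>I. d m x \<in> J}" "y \<in> {x\<in>I. d m x \<in> J}" "x \<le> u \<and> u \<le> y"
    then show "u \<in> {x\<in>I. d m x \<in> J}"
      using btw[of x y u] mem_is_interval_1_I[OF J, of "d m x" "d m y" "d m u"] by simp
  qed
  have "L = {x\<in>I. d m x \<in> {..-\<tau>}}" "M = {x\<in>I. d m x \<in> {-\<tau><..<\<tau>}}" "R = {x\<in>I. d m x \<in> {\<tau>..}}"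
    by (auto simp: L_def M_def R_def)
  then have int: "is_interval L" "is_interval M" "is_interval R"
    using preimage[of "{..-\<tau>}"] preimage[of "{-\<tau><..<\<tau>}"] preimage[of "{\<tau>..}"] by simp_all
  have sub: "L \<subseteq> I" "M \<subseteq> I" "R \<subseteq> I" by (auto simp: L_def M_def R_def)
  have bdd: "bounded L" "bounded M" "bounded R"
    using sub I(2) bounded_subset by blast+
  have lmeas: "L \<in> lmeasurable" "M \<in> lmeasurable" "R \<in> lmeasurable"
    using int bdd by (auto intro!: measurable_convex is_interval_convex)
  have "continuous_on I (d 0)"
    by (intro continuous_at_imp_continuous_on ballI) (use deriv[of 0] in \<open>blast intro: DERIV_isCont\<close>)
  then have E: "E \<in> lmeasurable"
    using lmeasurable_sublevel[OF I] unfolding E_def real_norm_def[symmetric] by blast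
  have "measure lebesgue (E \<inter> R) \<le> 4 * (2 ^ m - 1) * t"
  proof -
    have "measure lebesgue {x\<in>R. \<bar>d 0 x\<bar> < \<tau> * t ^ m} \<le> 4 * (2 ^ m - 1) * t"
      by (rule Suc.IH) (use int bdd sub deriv \<tau> pos in \<open>auto simp: R_def\<close>)
    moreover have "{x\<in>R. \<bar>d 0 x\<bar> < \<tau> * t ^ m} = E \<inter> R"
      using sub by (auto simp: E_def)
    ultimately show ?thesis by simp
  qed
  \<comment> \<open>On \<open>L\<close> the derivative \<open>d m\<close> is at most
    \<open>-\<tau>\<close>, so the whole family is negated, which leaves the sublevel set
    unchanged.\<close>
  moreover have "measure lebesgue (E \<inter> L) \<le> 4 * (2 ^ m - 1) * t"
  proof -
    have "measure lebesgue {x\<in>L. \<bar>- d 0 x\<bar> < \<tau> * t ^ m} \<le> 4 * (2 ^ m - 1) * t"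
      by (rule Suc.IH[where d = "\<lambda>i x. - d i x"])
        (use int bdd sub deriv \<tau> pos in \<open>auto simp: L_def intro!: DERIV_minus\<close>)
    moreover have "{x\<in>L. \<bar>- d 0 x\<bar> < \<tau> * t ^ m} = E \<inter> L"
      using sub by (auto simp: E_def)
    ultimately show ?thesis by simp
  qed
  \<comment> \<open>\<open>d m\<close> grows at rate at least \<open>\<kappa>\<close> and its values
    on \<open>M\<close> span at most \<open>2 * \<tau>\<close>, so \<open>M\<close> has diameter at
    most \<open>2 * t\<close>.\<close>
  moreover have "measure lebesgue (E \<inter> M) \<le> 2 * (2 * t)"
  proof (rule measure_le_of_diameter)
    have le: "\<bar>x - y\<bar> \<le> 2 * t" if "x \<in> M" "y \<in> M" "x \<le> y" for x y
    proof -
      have "\<kappa> * (y - x) \<le> 2 * \<tau>"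
        using expand[of x y] that by (auto simp: M_def)
      then have "\<kappa> * (y - x) \<le> \<kappa> * (2 * t)" by (simp add: \<tau>_def)
      then show ?thesis using pos that by simp
    qed
    show "\<bar>x - y\<bar> \<le> 2 * t" if "x \<in> E \<inter> M" "y \<in> E \<inter> M" for x y
      using le[of x y] le[of y x] that by (cases "x \<le> y") (auto simp: abs_minus_commute)
  qed (use E lmeas pos in auto)
  moreover have "measure lebesgue E \<le>
      measure lebesgue (E \<inter> L) + measure lebesgue (E \<inter> M) + measure lebesgue (E \<inter> R)"
  proof -
    have "E = (E \<inter> L \<union> E \<inter> M) \<union> E \<inter> R"
      by (auto simp: E_def L_def M_def R_def)
    then have "measure lebesgue E \<le> measure lebesgue (E \<inter> L \<union> E \<inter> M) + measure lebesgue (E \<inter> R)"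
      using E lmeas by (metis fmeasurableD measure_Un_le sets.Int sets.Un)
    moreover have "measure lebesgue (E \<inter> L \<union> E \<inter> M) \<le> measure lebesgue (E \<inter> L) + measure lebesgue (E \<inter> M)"
      using E lmeas by (intro measure_Un_le) auto
    ultimately show ?thesis by linarith
  qed
  \<comment> \<open>The constants add up:
    \<open>2 * 4 * (2 ^ m - 1) + 4 = 4 * (2 ^ Suc m - 1)\<close>.\<close>
  ultimately have "measure lebesgue E \<le> 4 * (2 ^ Suc m - 1) * t"
    by (simp add: algebra_simps)
  then show ?case
    by (simp add: E_def \<tau>_def mult.assoc)
qed

section \<open>Uniform estimates near a holomorphic function\<close>

text \<open>Continuity keeps the \<open>m\<close>-th derivative of \<open>F\<close> near its value
  at \<open>x\<^sub>0\<close>, and Cauchy's inequality transfers this to \<open>G\<close>. The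
  constants depend on \<open>F\<close> and \<open>x\<^sub>0\<close> but not on \<open>G\<close>;
  this uniformity is what yields an interior point rather than mere membership.\<close>

lemma uniform_measure_sublevel_le:
  fixes F :: "complex \<Rightarrow> complex"
  assumes S: "open S" and F: "F holomorphic_on S"
    and \<rho>: "\<rho> > 0" "cball (of_real x\<^sub>0) \<rho> \<subseteq> S"
    and nz: "(deriv ^^ m) F (of_real x\<^sub>0) \<noteq> 0"
  obtains \<eta> r k where "\<eta> > 0" "r > 0" "k > 0"
    "\<And>G t. G holomorphic_on S \<Longrightarrow> (\<And>z. z \<in> S \<Longrightarrow> norm (F z - G z) \<le> r) \<Longrightarrow> t > 0 \<Longrightarrow>
      measure lebesgue {x \<in> {x\<^sub>0 - \<eta><..<x\<^sub>0 + \<eta>}. norm (G (of_real x)) < k * t ^ m}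
        \<le> 4 * (2 ^ m - 1) * t"
proof -
  define c where "c = (deriv ^^ m) F (of_real x\<^sub>0)"
  define a where "a = norm c"
  have a: "a > 0" using nz by (simp add: a_def c_def)
  have x0: "of_real x\<^sub>0 \<in> S" using \<rho> by auto
  have "isCont ((deriv ^^ m) F) (of_real x\<^sub>0)"
    using F S x0 by (metis holomorphic_higher_deriv holomorphic_on_imp_continuous_on continuous_on_eq_continuous_at)
  then obtain e where e: "e > 0"
    "\<And>z. dist z (of_real x\<^sub>0) < e \<Longrightarrow> dist ((deriv ^^ m) F z) c < a / 4"
    unfolding continuous_at_eps_delta c_def using a by (metis divide_pos_pos zero_less_numeral)
  \<comment> \<open>Within \<open>e\<close> the \<open>m\<close>-th derivative of \<open>F\<close>
    is \<open>a / 4\<close>-close to \<open>c\<close>; within \<open>\<rho> / 2\<close> of the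
    centre, discs of radius \<open>\<rho> / 2\<close> stay in \<open>S\<close>.\<close>
  define \<eta> where "\<eta> = min e (\<rho> / 2)"
  \<comment> \<open>Solves \<open>fact m * r / (\<rho> / 2) ^ m = a / 4\<close>, the error allowed
    in Cauchy's inequality.\<close>
  define r where "r = a / 4 * (\<rho> / 2) ^ m / fact m"
  have pos: "\<eta> > 0" "r > 0" "a / 2 > 0"
    using e \<rho> a by (auto simp: \<eta>_def r_def)
  show ?thesis
  proof (rule that[OF pos])
    fix G :: "complex \<Rightarrow> complex" and t :: real
    assume G: "G holomorphic_on S" and close: "\<And>z. z \<in> S \<Longrightarrow> norm (F z - G z) \<le> r" and t: "t > 0"
    define I where "I = {x\<^sub>0 - \<eta><..<x\<^sub>0 + \<eta>}"
    \<comment> \<open>Multiplication by \<open>cnj c\<close> turns the reference value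
      \<open>c\<close> into the positive real \<open>a\<^sup>2\<close>.\<close>
    define d where "d i x = Re (cnj c * (deriv ^^ i) G (of_real x))" for i :: nat and x :: real
    have cball: "cball (of_real x) (\<rho> / 2) \<subseteq> S" if "x \<in> I" for x
    proof -
      have "\<bar>x - x\<^sub>0\<bar> \<le> \<rho> / 2"
        using that min.cobounded2[of e "\<rho> / 2"] unfolding I_def \<eta>_def greaterThanLessThan_iff
        by linarith
      then have "dist (of_real x :: complex) (of_real x\<^sub>0) \<le> \<rho> / 2"
        by (simp add: dist_real_def)
      then have "cball (of_real x :: complex) (\<rho> / 2) \<subseteq> cball (of_real x\<^sub>0) \<rho>"
        by (simp add: cball_subset_cball_iff dist_commute)
      then show ?thesis using \<rho>(2) by blast
    qed
    have IS: "of_real x \<in> S" if "x \<in> I" for x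
      using cball[OF that] \<rho>(1) by auto
    have deriv: "(d i has_real_derivative d (Suc i) x) (at x)" if "x \<in> I" for i x
    proof -
      have "((deriv ^^ i) G has_field_derivative (deriv ^^ Suc i) G (of_real x)) (at (of_real x))"
        using holomorphic_derivI[OF holomorphic_higher_deriv[OF G S] S IS[OF that]] by simp
      then have "((\<lambda>z. cnj c * (deriv ^^ i) G z) has_field_derivative
          cnj c * (deriv ^^ Suc i) G (of_real x)) (at (of_real x))"
        by (rule DERIV_cmult)
      then have "((\<lambda>x. cnj c * (deriv ^^ i) G (of_real x)) has_vector_derivative
          cnj c * (deriv ^^ Suc i) G (of_real x)) (at x)"
        by (rule has_vector_derivative_real_field)
      from bounded_linear.has_vector_derivative[OF bounded_linear_Re this]
      show ?thesis
        by (simp add: d_def[abs_def] has_real_derivative_iff_has_vector_derivative)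
    qed
    \<comment> \<open>Two errors of size \<open>a / 4\<close>, one from \<open>F\<close> and one
      from \<open>G\<close>, displace the derivative from \<open>c\<close> by at most
      \<open>a / 2\<close>; after multiplication by \<open>cnj c\<close> at least
      \<open>a\<^sup>2 - a\<^sup>2 / 2\<close> remains.\<close>
    have lower: "a\<^sup>2 / 2 \<le> d m x" if x: "x \<in> I" for x
    proof -
      have "norm ((deriv ^^ m) (\<lambda>z. F z - G z) (of_real x)) \<le> fact m * r / (\<rho> / 2) ^ m"
      proof (rule Cauchy_inequality)
        have hol: "(\<lambda>z. F z - G z) holomorphic_on cball (of_real x) (\<rho> / 2)"
          by (intro holomorphic_on_diff holomorphic_on_subset[OF F] holomorphic_on_subset[OF G] cball[OF x])
        then show "(\<lambda>z. F z - G z) holomorphic_on ball (of_real x) (\<rho> / 2)"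
          using ball_subset_cball holomorphic_on_subset by blast
        show "continuous_on (cball (of_real x) (\<rho> / 2)) (\<lambda>z. F z - G z)"
          by (rule holomorphic_on_imp_continuous_on[OF hol])
        show "norm (F z - G z) \<le> r" if "norm (of_real x - z) = \<rho> / 2" for z
          using that cball[OF x] by (intro close) (auto simp: dist_norm)
      qed (use \<rho> in auto)
      also have "\<dots> = a / 4" using \<rho> by (simp add: r_def)
      finally have 1: "norm ((deriv ^^ m) F (of_real x) - (deriv ^^ m) G (of_real x)) \<le> a / 4"
        using higher_deriv_diff[OF F G S IS[OF x]] by simp
      have "dist (of_real x :: complex) (of_real x\<^sub>0) < e"
        using x by (auto simp: I_def \<eta>_def dist_real_def)
      then have 2: "norm ((deriv ^^ m) F (of_real x) - c) \<le> a / 4"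
        using e(2) by (simp add: dist_norm less_imp_le)
      let ?w = "(deriv ^^ m) G (of_real x)"
      have "norm (c - ?w) \<le> a / 2"
        using norm_triangle_ineq[of "c - (deriv ^^ m) F (of_real x)" "(deriv ^^ m) F (of_real x) - ?w"] 1 2
        by (simp add: norm_minus_commute)
      then have "norm (cnj c * (c - ?w)) \<le> a * (a / 2)"
        using a by (simp add: norm_mult a_def)
      then have "Re (cnj c * (c - ?w)) \<le> a * (a / 2)"
        using complex_Re_le_cmod order_trans by blast
      moreover have "Re (cnj c * c) = a * a"
        using cmod_power2[of c] by (simp add: a_def power2_eq_square)
      ultimately show ?thesis
        by (simp add: d_def right_diff_distrib power2_eq_square)
    qed
    have cont: "continuous_on I (d 0)"
      by (intro continuous_at_imp_continuous_on ballI) (use deriv in \<open>blast intro: DERIV_isCont\<close>)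
    have "continuous_on I (\<lambda>x. G (of_real x))"
      using IS by (intro continuous_on_compose2[OF holomorphic_on_imp_continuous_on[OF G]] continuous_intros) auto
    then have meas: "{x\<in>I. norm (G (of_real x)) < a / 2 * t ^ m} \<in> lmeasurable"
      by (intro lmeasurable_sublevel) (auto simp: I_def)
    \<comment> \<open>As \<open>cnj c\<close> has modulus \<open>a\<close>, the factor
      \<open>a / 2\<close> for \<open>G\<close> corresponds to the lower bound
      \<open>a\<^sup>2 / 2\<close> on \<open>d m\<close>; this is why \<open>k\<close> is
      \<open>a / 2\<close>.\<close>
    have "\<bar>d 0 x\<bar> < a\<^sup>2 / 2 * t ^ m" if "norm (G (of_real x)) < a / 2 * t ^ m" for x
    proof -
      have "\<bar>d 0 x\<bar> \<le> a * norm (G (of_real x))"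
        unfolding d_def using abs_Re_le_cmod[of "cnj c * G (of_real x)"] by (simp add: norm_mult a_def)
      also have "\<dots> < a * (a / 2 * t ^ m)" using that a by simp
      finally show ?thesis by (simp add: power2_eq_square)
    qed
    then have sub: "{x\<in>I. norm (G (of_real x)) < a / 2 * t ^ m} \<subseteq> {x\<in>I. \<bar>d 0 x\<bar> < a\<^sup>2 / 2 * t ^ m}"
      by blast
    have "{x\<in>I. \<bar>d 0 x\<bar> < a\<^sup>2 / 2 * t ^ m} \<in> lmeasurable"
      using lmeasurable_sublevel[OF _ _ cont, of "a\<^sup>2 / 2 * t ^ m"] by (simp add: I_def)
    then have "measure lebesgue {x\<in>I. norm (G (of_real x)) < a / 2 * t ^ m}
        \<le> measure lebesgue {x\<in>I. \<bar>d 0 x\<bar> < a\<^sup>2 / 2 * t ^ m}"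
      by (rule measure_mono_fmeasurable[OF sub fmeasurableD[OF meas]])
    also have "\<dots> \<le> 4 * (2 ^ m - 1) * t"
      by (rule measure_sublevel_le) (use deriv lower t a in \<open>auto simp: I_def\<close>)
    finally show "measure lebesgue {x\<in>{x\<^sub>0 - \<eta><..<x\<^sub>0 + \<eta>}. norm (G (of_real x)) < a / 2 * t ^ m}
        \<le> 4 * (2 ^ m - 1) * t"
      unfolding I_def .
  qed
qed

text \<open>Split \<epsilon> as \<open>\<epsilon> powr (1 - \<alpha> * real m) * \<epsilon> powr
  (\<alpha> * real m)\<close>: the first factor has a positive exponent, so it tends to 0 and falls
  below \<open>k * c ^ m\<close>. With \<open>t = c * \<epsilon> powr \<alpha>\<close> in the
  preceding estimate, the strict bound on \<open>\<alpha> * real m\<close> thus buys an arbitrarily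
  small constant \<open>c\<close>.\<close>

lemma powr_sublevel_scale:
  fixes \<alpha> k c :: real
  assumes "\<alpha> * real m < 1" "k > 0" "c > 0"
  obtains \<epsilon>\<^sub>0 where "\<epsilon>\<^sub>0 > 0" "\<And>\<epsilon>. 0 < \<epsilon> \<Longrightarrow> \<epsilon> < \<epsilon>\<^sub>0 \<Longrightarrow> \<epsilon> < k * (c * \<epsilon> powr \<alpha>) ^ m"
proof -
  have "((\<lambda>\<epsilon>::real. \<epsilon> powr (1 - \<alpha> * real m)) \<longlongrightarrow> 0) (at_right 0)"
    using assms(1) by real_asymp
  then have "eventually (\<lambda>\<epsilon>::real. \<epsilon> powr (1 - \<alpha> * real m) < k * c ^ m) (at_right 0)"
    by (rule order_tendstoD) (use assms in simp)
  then obtain \<epsilon>\<^sub>0 where \<epsilon>\<^sub>0: "\<epsilon>\<^sub>0 > 0"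
    "\<And>\<epsilon>. 0 < \<epsilon> \<Longrightarrow> \<epsilon> < \<epsilon>\<^sub>0 \<Longrightarrow> \<epsilon> powr (1 - \<alpha> * real m) < k * c ^ m"
    by (auto simp: eventually_at_right_field)
  show ?thesis
  proof (rule that[OF \<epsilon>\<^sub>0(1)])
    fix \<epsilon> :: real assume \<epsilon>: "0 < \<epsilon>" "\<epsilon> < \<epsilon>\<^sub>0"
    have "\<epsilon> = \<epsilon> powr (1 - \<alpha> * real m) * \<epsilon> powr (\<alpha> * real m)"
      using \<epsilon> by (simp flip: powr_add)
    also have "\<dots> < k * c ^ m * \<epsilon> powr (\<alpha> * real m)"
      using \<epsilon>\<^sub>0(2)[OF \<epsilon>] \<epsilon> by (intro mult_strict_right_mono) auto
    also have "\<epsilon> powr (\<alpha> * real m) = (\<epsilon> powr \<alpha>) ^ m"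
      using \<epsilon> by (simp add: powr_power mult.commute)
    finally show "\<epsilon> < k * (c * \<epsilon> powr \<alpha>) ^ m"
      by (simp add: power_mult_distrib mult.assoc)
  qed
qed

section \<open>Zeros and multiplicities of analytic functions on the circle\<close>

lemma open_strip: "open {z. \<bar>Im z\<bar> < \<delta>}"
  by (intro open_Collect_less continuous_intros)

lemma connected_strip: "connected {z. \<bar>Im z\<bar> < \<delta>}"
proof -
  have "{z. \<bar>Im z\<bar> < \<delta>} = {z. Im z < \<delta>} \<inter> {z. Im z > -\<delta>}"
    by auto
  then show ?thesis
    by (metis convex_Int convex_connected convex_halfspace_Im_lt convex_halfspace_Im_gt)
qed

context
  fixes \<delta> :: real and f :: "real \<Rightarrow> complex"
  assumes \<delta>: "\<delta> > 0" and f: "f \<in> analytic_circle \<delta>"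
begin

lemma strip_ext_of_real: "strip_ext \<delta> f (of_real x) = f x"
  using extends_to_strip_ext[OF f] by (simp add: extends_to_strip_def)

lemma strip_ext_holomorphic: "strip_ext \<delta> f holomorphic_on {z. \<bar>Im z\<bar> < \<delta>}"
proof -
  have "strip_ext \<delta> f holomorphic_on strip \<delta>"
    using extends_to_strip_ext[OF f] by (simp add: extends_to_strip_def analytic_imp_holomorphic)
  then show ?thesis
    by (rule holomorphic_on_subset) (auto simp: strip_def)
qed

lemma continuous_analytic_circle: "continuous_on UNIV f"
proof -
  have "continuous_on UNIV (\<lambda>x. strip_ext \<delta> f (of_real x))"
    by (intro continuous_on_compose2[OF holomorphic_on_imp_continuous_on[OF strip_ext_holomorphic]]
        continuous_intros) (use \<delta> in auto)
  then show ?thesis by (simp add: strip_ext_of_real)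
qed

text \<open>On the strip, uniqueness identifies the chosen extension of the difference with the
  difference of the chosen extensions. This supplies the closeness hypothesis of the uniform
  estimate.\<close>

lemma norm_diff_le_strip_dist:
  assumes g: "g \<in> analytic_circle \<delta>" and z: "z \<in> strip \<delta>"
  shows "norm (strip_ext \<delta> f z - strip_ext \<delta> g z) \<le> strip_dist \<delta> f g"
proof -
  note diff = analytic_circle_diff[OF f g]
  have "norm (strip_ext \<delta> (\<lambda>x. f x - g x) z) \<le> strip_norm \<delta> (\<lambda>x. f x - g x)"
    using \<delta> z diff(1) by (intro norm_le_strip_norm) auto
  moreover have "strip_ext \<delta> (\<lambda>x. f x - g x) z = strip_ext \<delta> f z - strip_ext \<delta> g z"
    using \<delta> z by (intro extends_to_strip_unique[OF _ extends_to_strip_ext[OF diff(1)] diff(2)]) auto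
  ultimately show ?thesis
    using f g by (simp add: strip_dist_def)
qed

text \<open>\<open>max_zero_multiplicity\<close> sees only zeros in [0,1), while multiplicities are
  needed at all real points. The extension is known to be periodic only on the strip, but
  \<open>zorder\<close> depends only on the germ.\<close>

lemma zorder_strip_ext_periodic:
  "zorder (strip_ext \<delta> f) (of_real (x + of_int n)) = zorder (strip_ext \<delta> f) (of_real x)"
proof -
  let ?F = "strip_ext \<delta> f"
  have "zorder ?F (of_real (x + of_int n)) = zorder (\<lambda>u. ?F (u + of_real (x + of_int n))) 0"
    by (rule zorder_shift)
  also have "\<dots> = zorder (\<lambda>u. ?F (u + of_real x)) 0"
  proof (rule zorder_cong)
    have "eventually (\<lambda>u. u \<in> {z. \<bar>Im z\<bar> < \<delta>}) (nhds (0::complex))"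
      using \<delta> open_strip by (intro eventually_nhds_in_open) auto
    then have "eventually (\<lambda>u. u \<in> {z. \<bar>Im z\<bar> < \<delta>}) (at (0::complex))"
      by (auto simp: eventually_at_filter elim: eventually_mono)
    then show "eventually (\<lambda>u. ?F (u + of_real (x + of_int n)) = ?F (u + of_real x)) (at 0)"
    proof eventually_elim
      case (elim u)
      then have "u + of_real x \<in> strip \<delta>" by (simp add: strip_def)
      from strip_ext_periodic[OF _ f this, of n] show ?case
        using \<delta> by (simp add: add_ac)
    qed
  qed simp
  also have "\<dots> = zorder ?F (of_real x)"
    by (rule zorder_shift[symmetric])
  finally show ?thesis .
qed

lemma analytic_circle_periodic: "f (x + of_int n) = f x"
  using strip_ext_periodic[OF _ f, of "of_real x" n] \<delta> strip_ext_of_real[of "x + of_int n"]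
  by (simp add: strip_def strip_ext_of_real)

context
  assumes nz: "\<exists>x. f x \<noteq> 0"
begin

text \<open>If all derivatives vanished at one point, the extension would vanish on the connected
  open strip, hence \<open>f\<close> on the whole line.\<close>

lemma exists_higher_deriv_nonzero: "\<exists>n. (deriv ^^ n) (strip_ext \<delta> f) (of_real x) \<noteq> 0"
proof (rule ccontr)
  assume "\<nexists>n. (deriv ^^ n) (strip_ext \<delta> f) (of_real x) \<noteq> 0"
  then have "strip_ext \<delta> f (of_real y) = 0" for y
    by (intro holomorphic_fun_eq_0_on_connected[OF strip_ext_holomorphic open_strip connected_strip,
          where z = "of_real x"]) (use \<delta> in auto)
  then show False using nz by (simp add: strip_ext_of_real)
qed

text \<open>Infinitely many zeros would accumulate in the compact interval [0,1], inside the open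
  strip, and force the extension to vanish. Finiteness makes the \<open>Max\<close> in
  \<open>max_zero_multiplicity\<close> a genuine upper bound.\<close>

lemma finite_circle_zeros: "finite (circle_zeros f)"
proof (rule ccontr)
  assume inf: "infinite (circle_zeros f)"
  let ?U = "complex_of_real ` circle_zeros f"
  have "infinite ?U"
    using inf by (metis finite_imageD inj_of_real inj_on_subset subset_UNIV)
  moreover have "?U \<subseteq> of_real ` {0..1}"
    by (auto simp: circle_zeros_def)
  moreover have "compact (complex_of_real ` {0..1})"
    by (intro compact_continuous_image continuous_intros) auto
  ultimately obtain z where z: "z \<in> of_real ` {0..1}" "z islimpt ?U"
    by (meson Heine_Borel_imp_Bolzano_Weierstrass)
  have "strip_ext \<delta> f (of_real y) = 0" for y
    by (rule analytic_continuation[OF strip_ext_holomorphic open_strip connected_strip _ _ z(2)])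
      (use \<delta> z(1) in \<open>auto simp: strip_ext_of_real circle_zeros_def\<close>)
  then show False using nz by (simp add: strip_ext_of_real)
qed

lemma zorder_le_max_zero_multiplicity:
  assumes "f x = 0"
  shows "nat (zorder (strip_ext \<delta> f) (of_real x)) \<le> max_zero_multiplicity \<delta> f"
proof -
  define y where "y = x + of_int (- \<lfloor>x\<rfloor>)"
  have y: "y \<in> circle_zeros f"
    unfolding circle_zeros_def y_def using assms analytic_circle_periodic[of x "- \<lfloor>x\<rfloor>"]
    by auto linarith
  have "zorder (strip_ext \<delta> f) (of_real x) = zorder (strip_ext \<delta> f) (of_real y)"
    unfolding y_def by (rule zorder_strip_ext_periodic[symmetric])
  moreover have "nat (zorder (strip_ext \<delta> f) (of_real y)) \<le> max_zero_multiplicity \<delta> f"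
    using y finite_circle_zeros by (auto simp: max_zero_multiplicity_def)
  ultimately show ?thesis by simp
qed

text \<open>The least order \<open>m\<close> of a nonvanishing derivative is the
  \<open>zorder\<close> at the point. Where \<open>f\<close> does not vanish it is 0, which is
  within the bound even when \<open>f\<close> has no zeros; elsewhere the maximum bounds it.\<close>

lemma higher_deriv_nonzero_le_max_zero_multiplicity:
  obtains m where "(deriv ^^ m) (strip_ext \<delta> f) (of_real x) \<noteq> 0" "m \<le> max_zero_multiplicity \<delta> f"
proof -
  define m where "m = (LEAST n. (deriv ^^ n) (strip_ext \<delta> f) (of_real x) \<noteq> 0)"
  have m: "(deriv ^^ m) (strip_ext \<delta> f) (of_real x) \<noteq> 0"
    unfolding m_def by (rule LeastI_ex[OF exists_higher_deriv_nonzero])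
  have less: "(deriv ^^ i) (strip_ext \<delta> f) (of_real x) = 0" if "i < m" for i
    using not_less_Least[OF that[unfolded m_def]] by simp
  have "zorder (strip_ext \<delta> f) (of_real x) = int m"
    by (rule zorder_zero_eqI[OF strip_ext_holomorphic open_strip]) (use \<delta> m less in auto)
  moreover have "f x = 0" if "m \<noteq> 0"
    using less[of 0] that by (simp add: strip_ext_of_real)
  ultimately have "m \<le> max_zero_multiplicity \<delta> f"
    using zorder_le_max_zero_multiplicity[of x] by (cases "m = 0") auto
  with m that show thesis by blast
qed

end

end

section \<open>From local to global transversality\<close>

text \<open>The radii \<open>\<eta>\<close> and \<open>r\<close> are fixed before \<open>c\<close>:
  the number of neighbourhoods covering the circle depends on \<open>\<eta>\<close>, and
  \<open>c\<close> must later be small against that number. Only the threshold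
  \<open>\<epsilon>\<^sub>0\<close> depends on \<open>c\<close>.\<close>

lemma local_transversality:
  assumes \<delta>: "\<delta> > 0" and f: "f \<in> analytic_circle \<delta>" "\<exists>x. f x \<noteq> 0"
    and \<alpha>: "\<alpha> * real (max_zero_multiplicity \<delta> f) < 1" "\<alpha> > 0"
  obtains \<eta> r where "\<eta> > 0" "r > 0"
    "\<And>c. c > 0 \<Longrightarrow> \<exists>\<epsilon>\<^sub>0>0. \<forall>g\<in>analytic_circle \<delta>. strip_dist \<delta> f g < r \<longrightarrow>
       (\<forall>\<epsilon>. 0 < \<epsilon> \<and> \<epsilon> < \<epsilon>\<^sub>0 \<longrightarrow>
         measure lebesgue {x \<in> ball x\<^sub>0 \<eta>. norm (g x) < \<epsilon>} \<le> c * \<epsilon> powr \<alpha>)"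
proof -
  let ?S = "{z. \<bar>Im z\<bar> < \<delta>}"
  obtain m where m: "(deriv ^^ m) (strip_ext \<delta> f) (of_real x\<^sub>0) \<noteq> 0" "m \<le> max_zero_multiplicity \<delta> f"
    by (rule higher_deriv_nonzero_le_max_zero_multiplicity[OF \<delta> f])
  have "\<alpha> * real m \<le> \<alpha> * real (max_zero_multiplicity \<delta> f)"
    using m(2) \<alpha>(2) by simp
  with \<alpha>(1) have \<alpha>m: "\<alpha> * real m < 1" by linarith
  have "cball (of_real x\<^sub>0) (\<delta> / 2) \<subseteq> ?S"
  proof
    fix z assume "z \<in> cball (complex_of_real x\<^sub>0) (\<delta> / 2)"
    then show "z \<in> ?S"
      using abs_Im_le_cmod[of "of_real x\<^sub>0 - z"] \<delta> by (simp add: dist_norm)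
  qed
  from uniform_measure_sublevel_le[OF open_strip strip_ext_holomorphic[OF \<delta> f(1)] half_gt_zero[OF \<delta>] this m(1)]
  obtain \<eta> r k where pos: "\<eta> > 0" "r > 0" "k > 0"
    and bound: "\<And>G t. G holomorphic_on ?S \<Longrightarrow> (\<And>z. z \<in> ?S \<Longrightarrow> norm (strip_ext \<delta> f z - G z) \<le> r) \<Longrightarrow> t > 0 \<Longrightarrow>
      measure lebesgue {x \<in> {x\<^sub>0 - \<eta><..<x\<^sub>0 + \<eta>}. norm (G (of_real x)) < k * t ^ m}
        \<le> 4 * (2 ^ m - 1) * t"
    by blast
  show thesis
  proof (rule that[OF pos(1,2)])
    fix c :: real assume c: "c > 0"
    \<comment> \<open>Absorbs the factor \<open>4 * (2 ^ m - 1)\<close>, enlarged to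
      \<open>4 * 2 ^ m\<close> so that the divisor is positive also for
      \<open>m = 0\<close>.\<close>
    define c' where "c' = c / (4 * 2 ^ m)"
    have c': "c' > 0" using c by (simp add: c'_def)
    obtain \<epsilon>\<^sub>0 where \<epsilon>\<^sub>0: "\<epsilon>\<^sub>0 > 0" "\<And>\<epsilon>. 0 < \<epsilon> \<Longrightarrow> \<epsilon> < \<epsilon>\<^sub>0 \<Longrightarrow> \<epsilon> < k * (c' * \<epsilon> powr \<alpha>) ^ m"
      using powr_sublevel_scale[OF \<alpha>m pos(3) c'] by blast
    have "measure lebesgue {x \<in> ball x\<^sub>0 \<eta>. norm (g x) < \<epsilon>} \<le> c * \<epsilon> powr \<alpha>"
      if g: "g \<in> analytic_circle \<delta>" "strip_dist \<delta> f g < r" and \<epsilon>: "0 < \<epsilon>" "\<epsilon> < \<epsilon>\<^sub>0" for g \<epsilon>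
    proof -
      let ?t = "c' * \<epsilon> powr \<alpha>"
      have cont: "continuous_on A g" for A
        using continuous_analytic_circle[OF \<delta> g(1)] continuous_on_subset by blast
      have "measure lebesgue {x \<in> ball x\<^sub>0 \<eta>. norm (g x) < \<epsilon>}
          \<le> measure lebesgue {x \<in> ball x\<^sub>0 \<eta>. norm (g x) < k * ?t ^ m}"
        using \<epsilon>\<^sub>0(2)[OF \<epsilon>]
        by (intro measure_mono_fmeasurable fmeasurableD lmeasurable_sublevel cont)
          (auto simp: is_interval_ball_real)
      also have "\<dots> \<le> 4 * (2 ^ m - 1) * ?t"
      proof -
        have "norm (strip_ext \<delta> f z - strip_ext \<delta> g z) \<le> r" if "z \<in> ?S" for z
          using norm_diff_le_strip_dist[OF \<delta> f(1) g(1), of z] g(2) that by (simp add: strip_def)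
        then have "measure lebesgue {x \<in> {x\<^sub>0 - \<eta><..<x\<^sub>0 + \<eta>}. norm (strip_ext \<delta> g (of_real x)) < k * ?t ^ m}
            \<le> 4 * (2 ^ m - 1) * ?t"
          using c' \<epsilon> by (intro bound strip_ext_holomorphic[OF \<delta> g(1)]) auto
        then show ?thesis
          by (simp only: strip_ext_of_real[OF \<delta> g(1)] ball_eq_greaterThanLessThan)
      qed
      also have "\<dots> \<le> 4 * 2 ^ m * ?t"
        using c' by (intro mult_right_mono) auto
      also have "\<dots> = c * \<epsilon> powr \<alpha>" by (simp add: c'_def)
      finally show ?thesis .
    qed
    with \<epsilon>\<^sub>0(1) show "\<exists>\<epsilon>\<^sub>0>0. \<forall>g\<in>analytic_circle \<delta>. strip_dist \<delta> f g < r \<longrightarrow>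
       (\<forall>\<epsilon>. 0 < \<epsilon> \<and> \<epsilon> < \<epsilon>\<^sub>0 \<longrightarrow>
         measure lebesgue {x \<in> ball x\<^sub>0 \<eta>. norm (g x) < \<epsilon>} \<le> c * \<epsilon> powr \<alpha>)"
      by blast
  qed
qed

text \<open>The sublevel set is Borel because \<open>g\<close> is continuous, so
  \<open>lborel\<close> and its completion agree on it; the class is stated with the former, the
  estimates with the latter.\<close>

lemma measure_circle_sublevel:
  assumes "\<delta> > 0" "g \<in> analytic_circle \<delta>"
  shows "measure circle_measure {x \<in> space circle_measure. norm (g x) < \<epsilon>} =
    measure lebesgue {x \<in> {0..<1}. norm (g x) < \<epsilon>}"
proof -
  have "open {x. norm (g x) < \<epsilon>}"
    using continuous_analytic_circle[OF assms] by (intro open_Collect_less continuous_intros) auto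
  then have "{0..<1} \<inter> {x. norm (g x) < \<epsilon>} \<in> sets borel"
    by auto
  moreover have "{0..<1} \<inter> {x. norm (g x) < \<epsilon>} = {x \<in> {0..<1}. norm (g x) < \<epsilon>}"
    by auto
  ultimately have "{x \<in> {0..<1}. norm (g x) < \<epsilon>} \<in> sets lborel"
    by simp
  moreover have "measure circle_measure {x \<in> {0..<1}. norm (g x) < \<epsilon>} =
      measure lborel {x \<in> {0..<1}. norm (g x) < \<epsilon>}"
    unfolding circle_measure_def by (rule measure_restrict_space) auto
  ultimately show ?thesis
    by simp
qed

text \<open>Finitely many neighbourhoods cover the circle. The smallest of their radii
  \<open>r\<close> gives a metric ball around \<open>f\<close>, and the smallest of their thresholds
  an \<open>\<epsilon>\<^sub>0\<close> common to the whole ball.\<close>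

lemma interior_transversality_class:
  assumes \<delta>: "\<delta> > 0" and f: "f \<in> analytic_circle \<delta>" "\<exists>x. f x \<noteq> 0"
    and \<alpha>: "\<alpha> > 0" "ereal \<alpha> < inverse_max_multiplicity \<delta> f"
  shows "\<exists>\<epsilon>\<^sub>0>0. f \<in> strip_topology \<delta> interior_of transversality_class \<delta> \<alpha> \<epsilon>\<^sub>0"
proof -
  interpret G: Metric_space "analytic_circle \<delta>" "strip_dist \<delta>"
    using \<delta> by (intro Metric_space_strip_dist) simp
  \<comment> \<open>The product form also covers multiplicity 0, where the inverse is
    infinite.\<close>
  have "\<alpha> * real (max_zero_multiplicity \<delta> f) < 1"
    using \<alpha>(2) by (cases "max_zero_multiplicity \<delta> f = 0") (auto simp: inverse_max_multiplicity_def field_simps)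
  note loc = local_transversality[OF \<delta> f this \<alpha>(1)]
  \<comment> \<open>Naming the local property lets the radii be chosen as functions of the
    centre.\<close>
  define P where "P \<eta> r x\<^sub>0 \<longleftrightarrow> \<eta> > 0 \<and> r > 0 \<and> (\<forall>c>0. \<exists>\<epsilon>\<^sub>0>0. \<forall>g\<in>analytic_circle \<delta>.
      strip_dist \<delta> f g < r \<longrightarrow> (\<forall>\<epsilon>. 0 < \<epsilon> \<and> \<epsilon> < \<epsilon>\<^sub>0 \<longrightarrow>
         measure lebesgue {x \<in> ball x\<^sub>0 \<eta>. norm (g x) < \<epsilon>} \<le> c * \<epsilon> powr \<alpha>))" for \<eta> r x\<^sub>0
  have "\<exists>\<eta> r. P \<eta> r x\<^sub>0" for x\<^sub>0
    by (rule loc[of x\<^sub>0]) (unfold P_def, blast)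
  then obtain \<eta> r where P: "\<And>x\<^sub>0. P (\<eta> x\<^sub>0) (r x\<^sub>0) x\<^sub>0"
    by metis
  have \<eta>: "\<eta> x > 0" and r: "r x > 0" for x
    using P[of x] by (auto simp: P_def)
  have "{0..1} \<subseteq> (\<Union>x\<in>{0..1::real}. ball x (\<eta> x))"
    using \<eta> by auto
  then obtain D where D: "D \<subseteq> {0..1}" "finite D" "{0..1} \<subseteq> (\<Union>x\<in>D. ball x (\<eta> x))"
    by (rule compactE_image[OF compact_Icc open_ball])
  have "D \<noteq> {}" using D(3) by auto
  \<comment> \<open>The \<open>card D\<close> local bounds then add up to half of
    \<open>\<epsilon> powr \<alpha>\<close>, which leaves room for the strict inequality in the
    class.\<close>
  define c where "c = 1 / (2 * real (card D))"
  have c: "c > 0" using \<open>D \<noteq> {}\<close> D(2) by (simp add: c_def card_gt_0_iff)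
  \<comment> \<open>The thresholds are chosen only now, since they depend on
    \<open>c\<close>.\<close>
  define Q where "Q e x\<^sub>0 \<longleftrightarrow> e > 0 \<and> (\<forall>g\<in>analytic_circle \<delta>. strip_dist \<delta> f g < r x\<^sub>0 \<longrightarrow>
      (\<forall>\<epsilon>. 0 < \<epsilon> \<and> \<epsilon> < e \<longrightarrow>
         measure lebesgue {x \<in> ball x\<^sub>0 (\<eta> x\<^sub>0). norm (g x) < \<epsilon>} \<le> c * \<epsilon> powr \<alpha>))" for e x\<^sub>0
  have "\<exists>e. Q e x\<^sub>0" for x\<^sub>0
    using P[of x\<^sub>0] c unfolding P_def Q_def by blast
  then obtain e where Q: "\<And>x\<^sub>0. Q (e x\<^sub>0) x\<^sub>0"
    by metis
  have e: "e x\<^sub>0 > 0"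
    "g \<in> analytic_circle \<delta> \<Longrightarrow> strip_dist \<delta> f g < r x\<^sub>0 \<Longrightarrow> 0 < \<epsilon> \<Longrightarrow> \<epsilon> < e x\<^sub>0 \<Longrightarrow>
       measure lebesgue {x \<in> ball x\<^sub>0 (\<eta> x\<^sub>0). norm (g x) < \<epsilon>} \<le> c * \<epsilon> powr \<alpha>" for x\<^sub>0 g \<epsilon>
    using Q[of x\<^sub>0] unfolding Q_def by blast+
  define R where "R = Min (r ` D)"
  define \<epsilon>\<^sub>0 where "\<epsilon>\<^sub>0 = Min (e ` D)"
  have R: "R > 0" "\<And>x. x \<in> D \<Longrightarrow> R \<le> r x" and \<epsilon>\<^sub>0: "\<epsilon>\<^sub>0 > 0" "\<And>x. x \<in> D \<Longrightarrow> \<epsilon>\<^sub>0 \<le> e x"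
    using D(2) \<open>D \<noteq> {}\<close> r e(1) by (auto simp: R_def \<epsilon>\<^sub>0_def)
  have "G.mball f R \<subseteq> transversality_class \<delta> \<alpha> \<epsilon>\<^sub>0"
  proof
    fix g assume "g \<in> G.mball f R"
    then have g: "g \<in> analytic_circle \<delta>" "strip_dist \<delta> f g < R" by auto
    have "measure lebesgue {x \<in> {0..<1}. norm (g x) < \<epsilon>} < \<epsilon> powr \<alpha>" if \<epsilon>: "0 < \<epsilon>" "\<epsilon> < \<epsilon>\<^sub>0" for \<epsilon>
    proof -
      let ?E = "\<lambda>x\<^sub>0. {x \<in> ball x\<^sub>0 (\<eta> x\<^sub>0). norm (g x) < \<epsilon>}"
      have meas: "{x\<in>I. norm (g x) < \<epsilon>} \<in> lmeasurable" if "is_interval I" "bounded I" for I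
        using that continuous_analytic_circle[OF \<delta> g(1)] continuous_on_subset
        by (intro lmeasurable_sublevel) blast+
      have E: "?E x\<^sub>0 \<in> lmeasurable" for x\<^sub>0
        by (intro meas) (auto simp: is_interval_ball_real)
      have "measure lebesgue {x \<in> {0..<1}. norm (g x) < \<epsilon>} \<le> measure lebesgue (\<Union>x\<^sub>0\<in>D. ?E x\<^sub>0)"
      proof (rule measure_mono_fmeasurable)
        show "{x \<in> {0..<1}. norm (g x) < \<epsilon>} \<subseteq> (\<Union>x\<^sub>0\<in>D. ?E x\<^sub>0)"
          using D(3) by fastforce
        show "{x \<in> {0..<1}. norm (g x) < \<epsilon>} \<in> sets lebesgue"
          by (intro fmeasurableD meas) (auto simp: is_interval_co)
        show "(\<Union>x\<^sub>0\<in>D. ?E x\<^sub>0) \<in> lmeasurable"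
          using D(2) E by (intro fmeasurable.finite_UN) auto
      qed
      also have "\<dots> \<le> (\<Sum>x\<^sub>0\<in>D. measure lebesgue (?E x\<^sub>0))"
        using D(2) E by (intro measure_UNION_le) auto
      also have "\<dots> \<le> (\<Sum>x\<^sub>0\<in>D. c * \<epsilon> powr \<alpha>)"
        using g R \<epsilon> \<epsilon>\<^sub>0 by (intro sum_mono e(2)) (auto intro: less_le_trans)
      also have "\<dots> = \<epsilon> powr \<alpha> / 2"
        using D(2) \<open>D \<noteq> {}\<close> by (simp add: c_def)
      also have "\<dots> < \<epsilon> powr \<alpha>"
        using \<epsilon> by simp
      finally show ?thesis .
    qed
    then show "g \<in> transversality_class \<delta> \<alpha> \<epsilon>\<^sub>0"
      using g(1) unfolding transversality_class_def measure_circle_sublevel[OF \<delta> g(1), symmetric] by blast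
  qed
  then have "f \<in> strip_topology \<delta> interior_of transversality_class \<delta> \<alpha> \<epsilon>\<^sub>0"
    unfolding interior_of_def strip_topology_def using R(1) f(1)
    by (auto intro!: exI[of _ "G.mball f R"])
  with \<epsilon>\<^sub>0(1) show ?thesis by blast
qed

theorem theorem2p4:
  fixes \<delta> :: real
  assumes "\<delta> > 0"
  shows
    "(\<forall>f \<in> analytic_circle \<delta>.
        (\<exists>x. f x \<noteq> 0) \<and> (\<exists>x. f x = 0) \<longrightarrow>
        (\<forall>\<alpha>::real. 0 < \<alpha> \<and> ereal \<alpha> < inverse_max_multiplicity \<delta> f \<longrightarrow>
          (\<exists>\<epsilon>\<^sub>0>0. f \<in> transversality_class \<delta> \<alpha> \<epsilon>\<^sub>0)))
     \<and>
     (\<forall>f \<in> analytic_circle \<delta>.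
        (\<exists>x. f x \<noteq> 0) \<longrightarrow>
        (\<forall>\<alpha>::real. 0 < \<alpha> \<and> \<alpha> \<le> 1 \<and> ereal \<alpha> < inverse_max_multiplicity \<delta> f \<longrightarrow>
          (\<exists>\<epsilon>\<^sub>0>0. f \<in> strip_topology \<delta> interior_of transversality_class \<delta> \<alpha> \<epsilon>\<^sub>0)))"
\<comment> \<open>One context proves both parts: interior membership is (ii), and since an interior
  lies in its set it also gives (i).\<close>
proof (intro conjI ballI allI impI; elim conjE)
  fix f :: "real \<Rightarrow> complex" and \<alpha> :: real
  assume f: "f \<in> analytic_circle \<delta>" "\<exists>x. f x \<noteq> 0"
    and \<alpha>: "0 < \<alpha>" "ereal \<alpha> < inverse_max_multiplicity \<delta> f"
  obtain \<epsilon>\<^sub>0 where \<epsilon>\<^sub>0: "\<epsilon>\<^sub>0 > 0"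
    "f \<in> strip_topology \<delta> interior_of transversality_class \<delta> \<alpha> \<epsilon>\<^sub>0"
    using interior_transversality_class[OF assms f \<alpha>] by blast
  then show "\<exists>\<epsilon>\<^sub>0>0. f \<in> strip_topology \<delta> interior_of transversality_class \<delta> \<alpha> \<epsilon>\<^sub>0"
    by blast
  show "\<exists>\<epsilon>\<^sub>0>0. f \<in> transversality_class \<delta> \<alpha> \<epsilon>\<^sub>0"
    using \<epsilon>\<^sub>0 interior_of_subset[of "strip_topology \<delta>" "transversality_class \<delta> \<alpha> \<epsilon>\<^sub>0"] by blast
qed

end
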